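(* Let $p=2$ and let $h,u,c$ be nonnegative integers with $c\ge 1$ and $u\le 2^h$. If $0<u<2^h$, then the shifted almost minimum zero (SAMZ) estimate for $S(c2^h+u,2^h)$ is $$\nu_2(S(c2^h+u,2^h))\ge h-1-\nu_2(u).$$ Furthermore, among these $u$ (with $0<u<2^h$), the shifted almost minimum zero cases (i.e. the $u$ for which $S(c2^h+u,2^h)$ is a SAMZC) are exactly: $u$ even and $u\le 2^{h-1}$; $u=1$; and $u=1+2^{h-1}$. For these cases $S(c2^h+u-1,2^h-1)$ is an almost minimum zero case (AMZC) and $$\nu_2(S(c2^h+u,2^h))=\nu_2(S(c2^h+u-1,2^h-1))=h-1-\nu_2(u).$$
   Context: $S(n,k)$ is the Stirling number of the second kind; $\nu_2$ is the $2$-adic valuation. Higher order Bernoulli polynomials $B_m^{(l)}(x)$ ($m\ge 0$, $l\in\mathbb Z$) are defined by $\left(\frac{t}{e^t-1}\right)^l e^{tx}=\sum_{m\ge 0}B_m^{(l)}(x)\frac{t^m}{m!}$; $B_m^{(l)}(x)$ is monic of degree $m$ with rational coefficients, and $B_m^{(l)}=B_m^{(l)}(0)$. The maximum pole (here with respect to $p=2$) of a nonzero rational polynomial is the integer $M$ such that $-M$ is the minimum of the $2$-adic valuations of its coefficients. $S(n,k)$ is an almost minimum zero case (AMZC) if $\nu_2(S(n,k))=\nu_2\left(\binom nk\right)-M$, where $M$ is the maximum pole of $B_{n-k}^{(-k)}(x)$. The shifted almost minimum zero (SAMZ) estimate for $S(n,k)$ is $\nu_2(S(n,k))\ge\nu_2\left(\binom{n-1}{k-1}\right)-M'$,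 where $M'$ is the maximum pole of $B_{n-k}^{(-k+1)}(x)$; saying that it is $\nu_2(S(n,k))\ge E$ means $E=\nu_2\left(\binom{n-1}{k-1}\right)-M'$. $S(n,k)$ is a shifted almost minimum zero case (SAMZC) if equality holds in the SAMZ estimate. *)

theory Defs
  imports
    "HOL-Combinatorics.Stirling"
    "HOL-Computational_Algebra.Computational_Algebra"
begin

(* The value at 0 is the junk value 0 instead of infinity; it is never used below. *)
definition nu2 :: "rat \<Rightarrow> int" where
  "nu2 r = int (multiplicity 2 (fst (quotient_of r))) - int (multiplicity 2 (snd (quotient_of r)))"

lemma nu2_of_nat [simp]: "nu2 (of_nat n) = int (multiplicity 2 n)"
proof -
  have "quotient_of (of_nat n) = (int n, 1)"
    using quotient_of_int[of "int n"] by (simp add: Rat.of_int_def)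
  moreover have "multiplicity 2 (int n) = multiplicity 2 n"
  proof (cases "n = 0")
    case False
    have *: "(2 :: int) ^ k dvd int n \<longleftrightarrow> 2 ^ k dvd n" for k
      using int_dvd_int_iff[of "2 ^ k" n] by simp
    show ?thesis
    proof (rule multiplicity_eqI)
      show "(2 :: int) ^ multiplicity 2 n dvd int n"
        unfolding * by (rule multiplicity_dvd)
      show "\<not> (2 :: int) ^ Suc (multiplicity 2 n) dvd int n"
        unfolding * using False by (subst power_dvd_iff_le_multiplicity) auto
    qed
  qed simp
  ultimately show ?thesis by (simp add: nu2_def)
qed

(* t / (e^t - 1). Division of formal power series cancels the common factor t, so the
   quotient has constant coefficient 1 and its negative powers are genuine ones. *)
definition bernoulli_kernel :: "rat fps" where
  "bernoulli_kernel = fps_X / (fps_exp 1 - 1)"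

lemma bernoulli_kernel_mult: "bernoulli_kernel * (fps_exp 1 - 1) = fps_X"
proof -
  have "subdegree (fps_exp 1 - 1 :: rat fps) = 1"
    by (rule subdegreeI) auto
  moreover have "fps_exp 1 - 1 \<noteq> (0 :: rat fps)"
    using calculation by auto
  ultimately have "(fps_exp 1 - 1 :: rat fps) dvd fps_X"
    by (simp add: fps_dvd_iff)
  then show ?thesis
    unfolding bernoulli_kernel_def by simp
qed

lemma bernoulli_kernel_nth_0 [simp]: "fps_nth bernoulli_kernel 0 = 1"
proof -
  have "fps_nth (bernoulli_kernel * (fps_exp 1 - 1)) 1 = 1"
    by (simp add: bernoulli_kernel_mult)
  then show ?thesis
    by (simp add: fps_mult_nth)
qed

lemma bernoulli_kernel_powi_minus:
  "bernoulli_kernel powi l * bernoulli_kernel powi (- l) = 1"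
proof -
  have *: "inverse bernoulli_kernel ^ n * bernoulli_kernel ^ n = 1" for n
    by (metis bernoulli_kernel_nth_0 inverse_mult_eq_1 power_mult_distrib power_one zero_neq_one)
  show ?thesis
    using *[of "nat l"] *[of "nat (- l)"]
    by (auto simp: power_int_def mult.commute)
qed

(* The series (t / (e^t - 1))^l * e^(t x) in t, with coefficients in the polynomials in x. *)
definition bernoulli_gf :: "int \<Rightarrow> rat poly fps" where
  "bernoulli_gf l =
     Abs_fps (\<lambda>n. [:fps_nth (bernoulli_kernel powi l) n:]) * Abs_fps (\<lambda>n. monom (1 / fact n) n)"

definition bernoulli_poly :: "nat \<Rightarrow> int \<Rightarrow> rat poly" where
  "bernoulli_poly m l = smult (fact m) (fps_nth (bernoulli_gf l) m)"

(* Only meaningful for nonzero polynomials. *)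
definition max_pole :: "rat poly \<Rightarrow> int" where
  "max_pole f = - Min {nu2 (coeff f i) | i. coeff f i \<noteq> 0}"

definition amz_bound :: "nat \<Rightarrow> nat \<Rightarrow> int" where
  "amz_bound n k = nu2 (of_nat (n choose k)) - max_pole (bernoulli_poly (n - k) (- int k))"

definition AMZC :: "nat \<Rightarrow> nat \<Rightarrow> bool" where
  "AMZC n k \<longleftrightarrow> nu2 (of_nat (Stirling n k)) = amz_bound n k"

(* Right-hand side of the SAMZ estimate; intended for 1 \<le> k \<le> n. *)
definition samz_bound :: "nat \<Rightarrow> nat \<Rightarrow> int" where
  "samz_bound n k =
     nu2 (of_nat ((n - 1) choose (k - 1))) - max_pole (bernoulli_poly (n - k) (- int k + 1))"

definition SAMZC :: "nat \<Rightarrow> nat \<Rightarrow> bool" where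
  "SAMZC n k \<longleftrightarrow> nu2 (of_nat (Stirling n k)) = samz_bound n k"

lemma coeff_bernoulli_poly:
  "coeff (bernoulli_poly m l) j =
     (if j \<le> m then fact m / fact j * fps_nth (bernoulli_kernel powi l) (m - j) else 0)"
proof -
  have "coeff (bernoulli_poly m l) j =
      fact m * (\<Sum>i=0..m. fps_nth (bernoulli_kernel powi l) i * (if m - i = j then 1 / fact (m - i) else 0))"
    by (simp add: bernoulli_poly_def bernoulli_gf_def fps_mult_nth coeff_sum cong: if_cong)
  also have "\<dots> = fact m * (\<Sum>i=0..m. if i = m - j then (if j \<le> m then fps_nth (bernoulli_kernel powi l) i / fact j else 0) else 0)"
    by (rule arg_cong[of _ _ "\<lambda>x. fact m * x"], rule sum.cong) auto
  also have "\<dots> = (if j \<le> m then fact m / fact j * fps_nth (bernoulli_kernel powi l) (m - j) else 0)"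
    by simp
  finally show ?thesis .
qed

lemma bernoulli_poly_monic:
  "degree (bernoulli_poly m l) = m" "lead_coeff (bernoulli_poly m l) = 1"
proof -
  have "fps_nth (bernoulli_kernel powi l) 0 = 1"
    by (simp add: power_int_def fps_nth_power_0)
  then have 1: "coeff (bernoulli_poly m l) m = 1"
    by (simp add: coeff_bernoulli_poly)
  have "degree (bernoulli_poly m l) \<le> m"
    by (rule degree_le) (simp add: coeff_bernoulli_poly)
  moreover have "m \<le> degree (bernoulli_poly m l)"
    by (rule le_degree) (simp add: 1)
  ultimately show d: "degree (bernoulli_poly m l) = m" by simp
  show "lead_coeff (bernoulli_poly m l) = 1" using 1 d by simp
qed

end

theory Submission
  imports Defs
begin

text \<open>
Put n = c * 2^h + u, N = n - 1 and K = 2^h - 1. Up to the factor C(N, K), the coefficients of the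
Bernoulli polynomial are the summands of S(n, K + 1) = (SUM j. C(N, j) S(j, K)), so the SAMZ bound is
the least valuation of a summand. Since n C(N, j) = (j + 1) C(n, j + 1), everything depends on the
valuation of (j + 1) S(j, K). Newton's identity expresses this number through the power sums of
0, ..., K, which are 0 or 2^(h-1) modulo 2^h, and the numbers S(i, K), which are odd exactly if
i is at least K and 2^(h-1) divides i + 1. It follows that 2^(h-1) always divides (j + 1) S(j, K), and
that 2^h divides n S(N, K) exactly for the u not in the list. The minimum is attained at
j + 1 = c * 2^h + 2^v with v the valuation of u, and n S(n, K + 1) is congruent to n S(N, K) modulo 2^h.
\<close>

section \<open>Odd binomial coefficients\<close>

lemma odd_part_obtain:
  fixes u :: nat
  assumes "0 < u" "u < 2 ^ h"
  obtains v m where "u = 2 ^ v * m" "odd m" "v < h" "multiplicity 2 u = v"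
proof -
  obtain m where m: "u = 2 ^ multiplicity 2 u * m" "\<not> 2 dvd m"
    using multiplicity_decompose'[of u 2] assms by auto
  have "(2::nat) ^ multiplicity 2 u \<le> u"
    using assms by (intro dvd_imp_le multiplicity_dvd) auto
  with assms have "(2::nat) ^ multiplicity 2 u < 2 ^ h"
    by linarith
  with m that show thesis
    by auto
qed

text \<open>A special case of Lucas' theorem, by induction with the absorption identity: for
  \<open>Suc u\<close> below \<open>2 ^ h\<close>, the numbers \<open>Suc u\<close> and
  \<open>c * 2 ^ h + Suc u\<close> contain the same power of 2, which cancels and leaves odd
  factors.\<close>

lemma odd_choose_low_bits:
  fixes u :: nat
  assumes "u < 2 ^ h"
  shows "odd ((c * 2 ^ h + u) choose u)"
  using assms
proof (induction u)
  case (Suc u)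
  obtain v m where vm: "Suc u = 2 ^ v * m" "odd m" "v < h"
    using odd_part_obtain[of "Suc u" h] Suc.prems by (metis zero_less_Suc)
  then have "c * 2 ^ h + Suc u = 2 ^ v * (c * 2 ^ (h - v) + m)"
    by (simp add: distrib_left flip: power_add)
  moreover have "Suc u * ((c * 2 ^ h + Suc u) choose Suc u) = (c * 2 ^ h + Suc u) * ((c * 2 ^ h + u) choose u)"
    using Suc_times_binomial[of u "c * 2 ^ h + u"] by simp
  ultimately have "m * ((c * 2 ^ h + Suc u) choose Suc u) = (c * 2 ^ (h - v) + m) * ((c * 2 ^ h + u) choose u)"
    using vm(1) by (simp add: mult.assoc)
  moreover have "odd ((c * 2 ^ (h - v) + m) * ((c * 2 ^ h + u) choose u))"
    using Suc vm by simp
  ultimately show ?case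
    using vm(2) by (metis even_mult_iff)
qed simp

text \<open>Write v for the valuation of u and n for \<open>c * 2 ^ h + u\<close>. The product of
  C(n, c 2^h + 2^v) and C(c 2^h + 2^v, c 2^h) equals C(n, c 2^h) C(u, 2^v), where both factors are
  odd.\<close>

lemma odd_choose_lowest_bit:
  fixes u :: nat
  assumes "0 < u" "u < 2 ^ h"
  shows "odd ((c * 2 ^ h + u) choose (c * 2 ^ h + 2 ^ multiplicity 2 u))"
proof -
  obtain v m where vm: "u = 2 ^ v * m" "odd m" "v < h" "multiplicity 2 u = v"
    using odd_part_obtain assms by blast
  obtain m' where m': "m = Suc m'"
    using vm(2) by (cases m) auto
  \<comment> \<open>Absorption reduces C(u, 2^v) to the odd number m times a binomial coefficient
    whose lower entry \<open>2 ^ v - 1\<close> consists of the v low bits of its upper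
    entry.\<close>
  have "m * 2 ^ v choose 2 ^ v = m * ((m * 2 ^ v - 1) choose (2 ^ v - 1))"
    using binomial_absorption[of "2 ^ v - 1" "m * 2 ^ v"] by simp
  moreover have "m * 2 ^ v - 1 = m' * 2 ^ v + (2 ^ v - 1)"
    by (simp add: m')
  ultimately have *: "odd (u choose 2 ^ v)"
    using odd_choose_low_bits[of "2 ^ v - 1" v m'] vm(1,2) by (simp add: mult.commute)
  have "(c * 2 ^ h + u choose (c * 2 ^ h + 2 ^ v)) * (c * 2 ^ h + 2 ^ v choose (c * 2 ^ h)) =
        (c * 2 ^ h + u choose (c * 2 ^ h)) * (u choose 2 ^ v)"
    using choose_mult[of "c * 2 ^ h" "c * 2 ^ h + 2 ^ v" "c * 2 ^ h + u"] vm m' by simp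
  moreover have "odd (c * 2 ^ h + u choose (c * 2 ^ h))"
    using odd_choose_low_bits[of u h c] assms binomial_symmetric[of "c * 2 ^ h" "c * 2 ^ h + u"] by simp
  ultimately show ?thesis
    using * vm(4) by (metis even_mult_iff)
qed

section \<open>Parity of Stirling numbers with odd lower index\<close>

text \<open>Modulo 2 the term with an even factor drops out of the recurrence, so two applications
  of it lower either r by one or m by one. This is Pascal's rule for C(r + m, m).\<close>

lemma even_Stirling_odd_index_iff:
  "even (Stirling (2 * m + 1 + r) (2 * m + 1)) \<longleftrightarrow> even ((r + m) choose m)"
proof (induction "m + r" arbitrary: m r rule: less_induct)
  case less
  consider (r0) "r = 0" | (m0) "m = 0" | (Suc) r' m' where "r = Suc r'" "m = Suc m'"
    by (cases r; cases m) auto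
  then show ?case
  proof cases
    case m0
    then show ?thesis using Stirling_1[of r] by simp
  next
    case Suc
    define n where "n = 2 * m' + 1 + r"
    have n: "2 * m + 1 + r = Suc (Suc n)" "2 * m + 1 + r' = Suc n" "2 * m' + 1 + r = n"
      "2 * m + 1 = Suc (2 * m)" "2 * m = Suc (2 * m' + 1)"
      using Suc by (simp_all add: n_def)
    have "Stirling (Suc (Suc n)) (Suc (2 * m)) =
        Suc (2 * m) * Stirling (Suc n) (Suc (2 * m)) + Stirling (Suc n) (2 * m)"
      by (rule Stirling.simps(4))
    moreover have "Stirling (Suc n) (Suc (2 * m' + 1)) =
        Suc (2 * m' + 1) * Stirling n (Suc (2 * m' + 1)) + Stirling n (2 * m' + 1)"
      by (rule Stirling.simps(4))
    moreover have "even (Suc (2 * m' + 1))" "odd (Suc (2 * m))"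
      by simp_all
    ultimately have "even (Stirling (2 * m + 1 + r) (2 * m + 1)) \<longleftrightarrow>
          (even (Stirling (2 * m + 1 + r') (2 * m + 1)) \<longleftrightarrow>
           even (Stirling (2 * m' + 1 + r) (2 * m' + 1)))"
      unfolding n(1) unfolding n(2) unfolding n(3) unfolding n(4) unfolding n(5)
      by (simp del: Stirling.simps)
    also have "\<dots> \<longleftrightarrow> (even ((r' + m) choose m) \<longleftrightarrow> even ((r + m') choose m'))"
      using less[of m r'] less[of m' r] Suc by (simp del: Stirling.simps)
    also have "\<dots> \<longleftrightarrow> even ((r + m) choose m)"
      using Suc by auto
    finally show ?thesis .
  qed (simp del: Stirling.simps)
qed

text \<open>With q = 2^(h-1) and r = j + 1 - 2q, the parity is that of C(r + q - 1, q - 1). If q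
  divides r, the low bits decide; conversely q divides (r + q) C(r + q - 1, q - 1) by absorption, so
  an odd binomial coefficient forces q to divide r.\<close>

lemma odd_Stirling_pred_two_power_iff:
  assumes "h \<ge> 2"
  shows "odd (Stirling j (2 ^ h - 1)) \<longleftrightarrow> 2 ^ h \<le> Suc j \<and> 2 ^ (h - 1) dvd Suc j"
proof (cases "2 ^ h \<le> Suc j")
  case True
  define q :: nat where "q = 2 ^ (h - 1)"
  have q: "2 ^ h = 2 * q"
    using assms by (simp add: q_def flip: power_Suc)
  have "q \<ge> 2"
    using assms self_le_power[of "2::nat" "h - 1"] by (simp add: q_def)
  then have q': "2 ^ h - 1 = 2 * (q - 1) + 1"
    using q by simp
  define r where "r = Suc j - 2 * q"
  have j: "j = 2 * (q - 1) + 1 + r"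
    using True q \<open>q \<ge> 2\<close> by (simp add: r_def)
  have "odd (Stirling j (2 ^ h - 1)) \<longleftrightarrow> odd ((r + (q - 1)) choose (q - 1))"
    by (simp only: q' j even_Stirling_odd_index_iff)
  also have "\<dots> \<longleftrightarrow> q dvd r"
  proof
    assume "q dvd r"
    then obtain c where "r = c * q"
      by (metis dvd_def mult.commute)
    then show "odd ((r + (q - 1)) choose (q - 1))"
      using odd_choose_low_bits[of "q - 1" "h - 1" c] by (simp add: q_def)
  next
    assume odd: "odd ((r + (q - 1)) choose (q - 1))"
    have "q * ((r + q) choose q) = (r + q) * ((r + (q - 1)) choose (q - 1))"
      using binomial_absorption[of "q - 1" "r + q"] \<open>q \<ge> 2\<close> by simp
    then have "q dvd (r + q) * ((r + (q - 1)) choose (q - 1))"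
      by (metis dvd_triv_left)
    moreover have "coprime q ((r + (q - 1)) choose (q - 1))"
      using odd by (simp add: q_def)
    ultimately show "q dvd r"
      by (simp add: coprime_dvd_mult_left_iff)
  qed
  also have "\<dots> \<longleftrightarrow> q dvd Suc j"
  proof -
    have "Suc j = r + q * 2"
      using True q by (simp add: r_def)
    then show ?thesis by (simp add: dvd_add_left_iff)
  qed
  finally show ?thesis
    using True by (simp add: q_def)
qed simp

section \<open>Generating functions and Newton's identity\<close>

text \<open>As a rational function this is t^k / ((1 - t) (1 - 2t) ... (1 - kt)).\<close>

definition Stirling_gf :: "nat \<Rightarrow> int fps" where
  "Stirling_gf k = Abs_fps (\<lambda>n. int (Stirling n k))"

text \<open>The sum of a / (1 - at) over a from 0 to k. The exponent is shifted by one so that this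
  is the logarithmic derivative of the product of the 1 / (1 - at).\<close>

definition power_sum_gf :: "nat \<Rightarrow> int fps" where
  "power_sum_gf k = Abs_fps (\<lambda>l. \<Sum>a\<le>k. int a ^ Suc l)"

lemma Stirling_gf_Suc:
  "(1 - of_nat (Suc k) * fps_X) * Stirling_gf (Suc k) = fps_X * Stirling_gf k"
proof (rule fps_ext)
  fix n
  show "((1 - of_nat (Suc k) * fps_X) * Stirling_gf (Suc k)) $ n = (fps_X * Stirling_gf k) $ n"
    by (cases n) (auto simp: Stirling_gf_def ring_distribs mult.assoc fps_mult_of_nat_nth)
qed

lemma power_sum_gf_Suc:
  "(1 - of_nat (Suc k) * fps_X) * power_sum_gf (Suc k) =
   (1 - of_nat (Suc k) * fps_X) * power_sum_gf k + of_nat (Suc k)"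
proof -
  define E :: "int fps" where "E = Abs_fps (\<lambda>l. int (Suc k) ^ Suc l)"
  have "power_sum_gf (Suc k) = power_sum_gf k + E"
    by (rule fps_ext) (simp add: power_sum_gf_def E_def)
  moreover have "(1 - of_nat (Suc k) * fps_X) * E = of_nat (Suc k)"
  proof (rule fps_ext)
    fix n
    show "((1 - of_nat (Suc k) * fps_X) * E) $ n = of_nat (Suc k) $ n"
      by (cases n) (auto simp: E_def ring_distribs mult.assoc fps_mult_of_nat_nth simp flip: of_nat_Suc)
  qed
  ultimately show ?thesis
    by (simp only: distrib_left)
qed

text \<open>The logarithmic derivative of t^k / ((1 - t) ... (1 - kt)), with denominators cleared.
  In the induction everything is multiplied by \<open>g\<close>, the new linear factor, which is
  cancelled at the end.\<close>

lemma fps_deriv_Stirling_gf: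
  "fps_X * fps_deriv (Stirling_gf k) = of_nat k * Stirling_gf k + fps_X * power_sum_gf k * Stirling_gf k"
proof (induction k)
  case 0
  have "Stirling_gf 0 = 1"
    by (rule fps_ext) (auto simp: Stirling_gf_def gr0_conv_Suc)
  moreover have "power_sum_gf 0 = 0"
    by (rule fps_ext) (auto simp: power_sum_gf_def)
  ultimately show ?case by simp
next
  case (Suc k)
  define c where "c = (of_nat (Suc k) :: int fps)"
  define g where "g = 1 - c * fps_X"
  define G where "G = Stirling_gf (Suc k)"
  define R where "R = power_sum_gf (Suc k)"
  have gG: "g * G = fps_X * Stirling_gf k"
    unfolding g_def c_def G_def by (rule Stirling_gf_Suc)
  have gR: "g * R = g * power_sum_gf k + c"
    unfolding g_def c_def R_def by (rule power_sum_gf_Suc)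
  have dg: "fps_deriv g = - c"
    by (simp add: g_def c_def)
  have "fps_X * fps_deriv (g * G) = fps_X * fps_deriv (fps_X * Stirling_gf k)"
    by (simp only: gG)
  also have "\<dots> = g * G + fps_X * (fps_X * fps_deriv (Stirling_gf k))"
    by (simp only: gG) (simp add: algebra_simps)
  also have "\<dots> = g * G + (of_nat k + fps_X * power_sum_gf k) * (g * G)"
    by (simp only: Suc gG) (simp add: algebra_simps)
  finally have "fps_X * (g * fps_deriv G) =
      (1 + of_nat k + fps_X * power_sum_gf k) * (g * G) + c * fps_X * G"
    by (simp add: dg algebra_simps)
  also have "\<dots> = c * (g * G) + fps_X * (g * power_sum_gf k + c) * G"
    by (simp add: c_def algebra_simps)
  also have "\<dots> = g * (c * G + fps_X * R * G)"
    by (simp only: gR[symmetric]) (simp add: algebra_simps)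
  finally have "g * (fps_X * fps_deriv G) = g * (c * G + fps_X * R * G)"
    by (simp add: algebra_simps)
  moreover have "g $ 0 = 1"
    by (simp add: g_def)
  then have "g \<noteq> 0" by auto
  ultimately show ?case
    by (simp add: c_def G_def R_def)
qed

text \<open>Newton's identity, S(j, k) being the complete homogeneous symmetric polynomial of degree j - k in 0, ..., k.\<close>
lemma Stirling_newton:
  "int j * int (Stirling j k) =
   int k * int (Stirling j k) + (\<Sum>l<j. (\<Sum>a\<le>k. int a ^ Suc l) * int (Stirling (j - 1 - l) k))"
proof (cases j)
  case (Suc i)
  have "(fps_X * fps_deriv (Stirling_gf k)) $ Suc i =
      (of_nat k * Stirling_gf k + fps_X * (power_sum_gf k * Stirling_gf k)) $ Suc i"
    by (simp only: fps_deriv_Stirling_gf mult.assoc)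
  moreover have "(power_sum_gf k * Stirling_gf k) $ i =
      (\<Sum>l<Suc i. (\<Sum>a\<le>k. int a ^ Suc l) * int (Stirling (i - l) k))"
    by (simp add: fps_mult_nth Stirling_gf_def power_sum_gf_def lessThan_Suc_atMost atLeast0AtMost)
  moreover have "fps_deriv (Stirling_gf k) $ i = int j * int (Stirling j k)"
    by (simp only: fps_deriv_nth Stirling_gf_def Suc fps_nth_Abs_fps Suc_eq_plus1 of_nat_id)
  moreover have "(of_nat k * Stirling_gf k) $ Suc i = int k * int (Stirling j k)"
    by (simp add: Stirling_gf_def Suc fps_mult_of_nat_nth del: Stirling.simps)
  ultimately show ?thesis
    by (simp add: Suc del: Stirling.simps sum.lessThan_Suc)
next
  case 0
  then show ?thesis by (cases k) auto
qed

section \<open>Power sums over 0, ..., 2^h - 1 modulo 2^h\<close>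

lemma power_add_linear_dvd:
  fixes a M :: int
  shows "M\<^sup>2 dvd (a + M) ^ Suc s - a ^ Suc s - int (Suc s) * M * a ^ s"
proof (induction s)
  case (Suc s)
  have "(a + M) ^ Suc (Suc s) - a ^ Suc (Suc s) - int (Suc (Suc s)) * M * a ^ Suc s =
      (a + M) * ((a + M) ^ Suc s - a ^ Suc s - int (Suc s) * M * a ^ s) + M\<^sup>2 * (int (Suc s) * a ^ s)"
    by (simp add: algebra_simps power2_eq_square)
  also have "M\<^sup>2 dvd \<dots>"
    using Suc by (intro dvd_add[OF dvd_mult dvd_triv_left])
  finally show ?case .
qed simp

lemma sum_lessThan_double:
  fixes f :: "nat \<Rightarrow> 'a :: comm_monoid_add"
  shows "(\<Sum>a<2 * M. f a) = (\<Sum>a<M. f a) + (\<Sum>a<M. f (a + M))"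
proof -
  have "(\<Sum>a<N + M. f a) = (\<Sum>a<M. f a) + (\<Sum>a<N. f (a + M))" for N
    by (induction N) (auto simp: add_ac)
  then show ?thesis by (simp add: mult_2)
qed

text \<open>The range is split into halves of length M = 2^(g+1), and the upper half is expanded to
  first order in M. The error is a multiple of M^2, hence of 2^(g+2).\<close>

lemma sum_powers_double:
  "2 ^ Suc (Suc g) dvd (\<Sum>a<2 ^ Suc (Suc g). int a ^ Suc s) -
     (2 * (\<Sum>a<2 ^ Suc g. int a ^ Suc s) + int (Suc s) * 2 ^ Suc g * (\<Sum>a<2 ^ Suc g. int a ^ s))"
proof -
  define M :: nat where "M = 2 ^ Suc g"
  have "(\<Sum>a<2 ^ Suc (Suc g). int a ^ Suc s) -
     (2 * (\<Sum>a<M. int a ^ Suc s) + int (Suc s) * int M * (\<Sum>a<M. int a ^ s)) =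
     (\<Sum>a<M. (int a + int M) ^ Suc s - int a ^ Suc s - int (Suc s) * int M * int a ^ s)"
    using sum_lessThan_double[of "\<lambda>a. int a ^ Suc s" M]
    by (simp add: M_def sum_subtractf sum_distrib_left)
  also have "(int M)\<^sup>2 dvd \<dots>"
    by (intro dvd_sum power_add_linear_dvd)
  finally show ?thesis
    unfolding M_def of_nat_power of_nat_numeral
    by (rule dvd_trans[rotated]) (simp add: power2_eq_square)
qed

text \<open>If the coefficient of 2^(g+1) in the first-order term is even, that term vanishes modulo
  2^(g+2), and doubling the range doubles the residue.\<close>

lemma sum_powers_double_step:
  assumes "2 ^ Suc g dvd (\<Sum>a<2 ^ Suc g. int a ^ Suc s) - b"
    and "even (int (Suc s) * (\<Sum>a<2 ^ Suc g. int a ^ s))"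
  shows "2 ^ Suc (Suc g) dvd (\<Sum>a<2 ^ Suc (Suc g). int a ^ Suc s) - 2 * b"
proof -
  define X where "X = (\<Sum>a<2 ^ Suc (Suc g). int a ^ Suc s)"
  define A where "A = (\<Sum>a<2 ^ Suc g. int a ^ Suc s)"
  define Y where "Y = int (Suc s) * 2 ^ Suc g * (\<Sum>a<2 ^ Suc g. int a ^ s)"
  have "2 ^ Suc (Suc g) dvd X - (2 * A + Y)"
    unfolding X_def A_def Y_def by (rule sum_powers_double)
  moreover have "2 ^ Suc (Suc g) dvd 2 * (A - b)"
    using mult_dvd_mono[OF dvd_refl[of 2] assms(1)] unfolding A_def power_Suc[of 2 "Suc g"] .
  moreover have "2 ^ Suc (Suc g) dvd Y"
    using mult_dvd_mono[OF assms(2) dvd_refl[of "2 ^ Suc g"]] unfolding Y_def power_Suc[of 2 "Suc g"]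
    by (simp only: mult_ac)
  ultimately have "2 ^ Suc (Suc g) dvd X - (2 * A + Y) + 2 * (A - b) + Y"
    by (intro dvd_add)
  then show ?thesis
    by (simp add: X_def)
qed

text \<open>The exponent \<open>Suc s\<close> is even, so it alone makes the first-order coefficient
  even. The residue starts from 0 + 1 at g = 0 and doubles.\<close>

lemma sum_powers_even_exponent:
  assumes "odd s"
  shows "2 ^ Suc g dvd (\<Sum>a<2 ^ Suc g. int a ^ Suc s) - 2 ^ g"
proof (induction g)
  case (Suc g)
  have "2 ^ Suc (Suc g) dvd (\<Sum>a<2 ^ Suc (Suc g). int a ^ Suc s) - 2 * 2 ^ g"
    using assms by (intro sum_powers_double_step[OF Suc] dvd_mult2) simp
  then show ?case
    by (simp only: power_Suc)
qed (simp add: lessThan_Suc numeral_2_eq_2)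

lemma sum_naturals_two_power:
  "2 ^ Suc g dvd (\<Sum>a<2 ^ Suc g. int a) - 2 ^ g"
proof (induction g)
  case (Suc g)
  have "2 ^ Suc (Suc g) dvd (\<Sum>a<2 ^ Suc (Suc g). int a ^ Suc 0) - 2 * 2 ^ g"
  proof (rule sum_powers_double_step)
    show "2 ^ Suc g dvd (\<Sum>a<2 ^ Suc g. int a ^ Suc 0) - 2 ^ g"
      using Suc by (simp only: power_one_right One_nat_def[symmetric])
  qed simp
  then show ?case
    by (simp only: power_Suc power_0 mult_1_right)
qed (simp add: lessThan_Suc numeral_2_eq_2)

text \<open>For odd exponents from 3 on, the residue is 0 from g = 1 onwards; at g = 0 the sum is 1,
  which is why the induction starts at 1.\<close>

lemma sum_powers_odd_exponent:
  assumes "even s" "s > 0" "g \<ge> 1"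
  shows "2 ^ Suc g dvd (\<Sum>a<2 ^ Suc g. int a ^ Suc s)"
  using assms(3)
proof (induction g rule: dec_induct)
  case base
  obtain t where s: "s = 2 * Suc t"
    using assms(1,2) by (metis evenE gr0_implies_Suc mult_0_right neq0_conv)
  have *: "(4::int) dvd 9 ^ k - 1" for k
  proof (induction k)
    case (Suc k)
    have "(9::int) ^ Suc k - 1 = (9 ^ k - 1) + 4 * (2 * 9 ^ k)" by simp
    with Suc show ?case by (metis dvd_add dvd_triv_left)
  qed simp
  have "{..<2 ^ Suc 1} = {0, 1, 2, 3::nat}" by auto
  then have "(\<Sum>a<2 ^ Suc 1. int a ^ Suc s) = 1 + 2 ^ Suc s + 3 ^ Suc s"
    by simp
  \<comment> \<open>Since s = 2(t + 1), the powers are 2^(s+1) = 8 * 4^t and 3^(s+1) = 3 * 9^(t+1);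
    subtracting 1 from the power of 9 leaves 1 + 3 = 4.\<close>
  also have "\<dots> = 3 * (9 ^ Suc t - 1) + 4 * (1 + 2 * 4 ^ t)"
    by (simp add: s power_mult)
  finally have "(\<Sum>a<2 ^ Suc 1. int a ^ Suc s) = 3 * (9 ^ Suc t - 1) + 4 * (1 + 2 * 4 ^ t)" .
  moreover have "4 dvd 3 * (9 ^ Suc t - 1) + 4 * (1 + 2 * 4 ^ t :: int)"
    using dvd_mult[OF *[of "Suc t"], of 3] by (rule dvd_add) (rule dvd_triv_left)
  ultimately show ?case by simp
next
  case (step g)
  obtain r where r: "s = Suc r" "odd r"
    using assms by (cases s) auto
  \<comment> \<open>The first-order coefficient contains a power sum with even exponent s, which is
    2^g modulo 2^(g+1) and hence even because g is positive.\<close>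
  have "even ((\<Sum>a<2 ^ Suc g. int a ^ s) - 2 ^ g)"
    using sum_powers_even_exponent[OF r(2), of g] unfolding r(1) power_Suc[of 2 g]
    by (rule dvd_mult_left)
  moreover have "even ((2 :: int) ^ g)"
    using step.hyps by (cases g) auto
  ultimately have "even ((\<Sum>a<2 ^ Suc g. int a ^ s) - 2 ^ g + 2 ^ g)"
    by (rule dvd_add)
  then show ?case
    using sum_powers_double_step[of g s 0] step.IH by simp
qed

text \<open>The exponent is l + 1, so odd l means an even exponent and l = 0 means exponent
  one.\<close>

lemma sum_powers_mod_two_power:
  assumes "g \<ge> 1"
  shows "2 ^ Suc g dvd (\<Sum>a<2 ^ Suc g. int a ^ Suc l) - (if l = 0 \<or> odd l then 2 ^ g else 0)"
proof (cases "l = 0")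
  case True
  then show ?thesis
    using sum_naturals_two_power[of g]
    by (simp only: power_one_right if_True simp_thms One_nat_def[symmetric])
next
  case l: False
  show ?thesis
  proof (cases "odd l")
    case True
    then show ?thesis
      using sum_powers_even_exponent[of l g] by (simp only: if_True simp_thms)
  next
    case False
    with l have "even l" "0 < l" and nl: "\<not> (l = 0 \<or> odd l)" by simp_all
    then show ?thesis
      unfolding if_not_P[OF nl] diff_zero by (intro sum_powers_odd_exponent assms)
  qed
qed

section \<open>The multiples (j + 1) S(j, 2^h - 1) modulo 2^h\<close>

text \<open>In Newton's identity for K = 2^(g+1) - 1 the left factor j - K is j + 1 modulo 2^(g+1),
  and each power sum may be replaced by its residue.\<close>

lemma Stirling_pred_two_power_cong:
  assumes "g \<ge> 1"
  shows "2 ^ Suc g dvd int (Suc j * Stirling j (2 ^ Suc g - 1)) -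
    2 ^ g * (\<Sum>l<j. if l = 0 \<or> odd l then int (Stirling (j - 1 - l) (2 ^ Suc g - 1)) else 0)"
proof -
  define K :: nat where "K = 2 ^ Suc g - 1"
  have Suc_K: "Suc K = 2 ^ Suc g"
    by (simp add: K_def)
  have "1 + int K = int (Suc K)" by simp
  then have K: "{..K} = {..<2 ^ Suc g}" "1 + int K = 2 ^ Suc g"
    by (simp_all only: Suc_K[symmetric] lessThan_Suc_atMost) (simp only: Suc_K of_nat_power of_nat_numeral)
  \<comment> \<open>The error made by replacing a power sum by its residue, a multiple of
    2^(g+1).\<close>
  define D where "D l = (\<Sum>a<2 ^ Suc g. int a ^ Suc l) - (if l = 0 \<or> odd l then 2 ^ g else 0)" for l
  have "2 ^ Suc g dvd 2 ^ Suc g * int (Stirling j K) + (\<Sum>l<j. D l * int (Stirling (j - 1 - l) K))"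
    unfolding D_def
    by (rule dvd_add[OF dvd_triv_left dvd_sum[OF dvd_mult2[OF sum_powers_mod_two_power[OF assms]]]])
  also have "(\<Sum>l<j. D l * int (Stirling (j - 1 - l) K)) =
      (\<Sum>l<j. (\<Sum>a<2 ^ Suc g. int a ^ Suc l) * int (Stirling (j - 1 - l) K)) -
      2 ^ g * (\<Sum>l<j. if l = 0 \<or> odd l then int (Stirling (j - 1 - l) K) else 0)"
    unfolding D_def sum_distrib_left sum_subtractf[symmetric] by (intro sum.cong) (auto simp: left_diff_distrib)
  also have "(\<Sum>l<j. (\<Sum>a<2 ^ Suc g. int a ^ Suc l) * int (Stirling (j - 1 - l) K)) =
      int j * int (Stirling j K) - int K * int (Stirling j K)"
    using Stirling_newton[of j K] by (simp only: K(1))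
  also have "2 ^ Suc g * int (Stirling j K) + (int j * int (Stirling j K) - int K * int (Stirling j K) - W) =
      int (Suc j * Stirling j K) - W" for W
    by (simp only: K(2)[symmetric]) (simp add: algebra_simps)
  finally show ?thesis
    unfolding K_def .
qed

lemma two_power_dvd_Suc_mult_Stirling:
  "2 ^ (h - 1) dvd Suc j * Stirling j (2 ^ h - 1)"
proof (cases "h \<ge> 2")
  case True
  define g where "g = h - 1"
  have g: "h = Suc g" "g \<ge> 1"
    using True by (auto simp: g_def)
  let ?X = "int (Suc j * Stirling j (2 ^ h - 1))"
  obtain W where "2 ^ h dvd ?X - 2 ^ g * W"
    using Stirling_pred_two_power_cong[OF g(2), of j] unfolding g(1)[symmetric] by blast
  then have "2 ^ g dvd ?X - 2 ^ g * W"
    by (rule dvd_trans[rotated]) (simp add: g(1))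
  then have "2 ^ g dvd (?X - 2 ^ g * W) + 2 ^ g * W"
    by (intro dvd_add) auto
  then have "int (2 ^ g) dvd ?X"
    by simp
  then show ?thesis
    unfolding of_nat_dvd_iff g_def .
next
  case False
  \<comment> \<open>Truncated subtraction makes the claim trivial for h = 0 as well as for h =
    1.\<close>
  then have "h - 1 = 0" by simp
  then show ?thesis by simp
qed

text \<open>For n = 2cq + u with even u, the odd terms are those with n - 1 - l = kq for k = 2, ..., 2c
  (and also k = 2c + 1 if u > q).\<close>
lemma card_odd_Stirling_terms:
  fixes c u q :: nat
  assumes "c \<ge> 1" "0 < u" "u < 2 * q" "even q" and n: "n = 2 * c * q + u"
  shows "odd (card {l. l < n - 1 \<and> (l = 0 \<or> odd l) \<and> 2 * q \<le> n - 1 - l \<and> q dvd n - 1 - l}) \<longleftrightarrow>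
    (even u \<and> u \<le> q) \<or> u = 1 \<or> u = 1 + q" (is "odd (card ?L) \<longleftrightarrow> _")
proof (cases "even u")
  case False
  then have "odd n"
    using n assms(4) by simp
  have n1: "n - 1 = 2 * c * q + (u - 1)"
    using assms by simp
  have "2 * q \<le> 2 * c * q"
    using assms(1) by simp
  then have "2 * q \<le> n - 1" "0 < n - 1"
    using assms(2,3) n1 by linarith+
  then have *: "0 \<in> ?L \<longleftrightarrow> q dvd n - 1"
    by simp
  \<comment> \<open>As n - 1 is even, an odd l would make n - 1 - l odd, and the even q could not
    divide it.\<close>
  have **: "l = 0" if "l \<in> ?L" for l
  proof (rule ccontr)
    assume "l \<noteq> 0"
    with that have "odd l" "l < n - 1" "q dvd n - 1 - l" by auto
    moreover from this have "n = Suc (l + (n - 1 - l))" by simp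
    then have "odd n \<longleftrightarrow> even (l + (n - 1 - l))" by (metis even_Suc)
    moreover have "even (n - 1 - l)"
      using assms(4) \<open>q dvd n - 1 - l\<close> by (rule dvd_trans)
    ultimately show False
      using \<open>odd n\<close> by simp
  qed
  have "?L = (if q dvd n - 1 then {0} else {})"
  proof (cases "q dvd n - 1")
    case True
    with * have "{0} \<subseteq> ?L" by blast
    moreover have "?L \<subseteq> {0}" using ** by blast
    ultimately show ?thesis
      unfolding if_P[OF True] by (intro equalityI)
  next
    case False
    with * ** have "?L = {}" by blast
    then show ?thesis
      unfolding if_not_P[OF False] .
  qed
  moreover have "q dvd n - 1 \<longleftrightarrow> q dvd u - 1"
    unfolding n1 by simp
  moreover have "q dvd u - 1 \<longleftrightarrow> u = 1 \<or> u = 1 + q"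
  proof
    assume "q dvd u - 1"
    then obtain t where "u - 1 = q * t" by blast
    moreover from this have "q * t < q * 2"
      using assms(3) by linarith
    then have "t < 2" by simp
    ultimately show "u = 1 \<or> u = 1 + q"
      using assms(2) by (cases t) auto
  qed auto
  ultimately show ?thesis
    using False by auto
next
  case True
  \<comment> \<open>The largest k with k q < n.\<close>
  define m where "m = 2 * c + (if u \<le> q then 0 else 1)"
  have "even n"
    using n True by simp
  have m: "k * q < n \<longleftrightarrow> k \<le> m" for k
  proof
    assume "k * q < n"
    also have "n \<le> Suc m * q"
      using assms(3) n by (cases "u \<le> q") (simp_all add: m_def distrib_right)
    finally have "k * q < Suc m * q" .
    then have "k < Suc m" by (simp only: mult_less_cancel2)
    then show "k \<le> m" by simp
  next
    assume "k \<le> m"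
    then have "k * q \<le> m * q" by simp
    also have "\<dots> < n"
      using assms(2) n by (cases "u \<le> q") (simp_all add: m_def distrib_right)
    finally show "k * q < n" .
  qed
  \<comment> \<open>Here n - 1 is odd and k q is even, so l = n - 1 - k q is automatically
    odd.\<close>
  have "?L = (\<lambda>k. n - 1 - k * q) ` {2..m}"
  proof (intro equalityI subsetI)
    fix l assume l: "l \<in> ?L"
    then have "l < n - 1" "2 * q \<le> n - 1 - l" "q dvd n - 1 - l" by simp_all
    moreover from this obtain k where k: "n - 1 - l = q * k" by blast
    ultimately have "2 * q \<le> k * q" "k * q < n" and l_eq: "l = n - 1 - k * q"
      using assms(2) n by (simp_all add: mult.commute)
    then have "2 \<le> k" "k \<le> m"
      using assms(3) m by simp_all
    then show "l \<in> (\<lambda>k. n - 1 - k * q) ` {2..m}"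
      unfolding l_eq by (intro imageI) simp
  next
    fix l assume "l \<in> (\<lambda>k. n - 1 - k * q) ` {2..m}"
    then obtain k where k: "2 \<le> k" "k \<le> m" "l = n - 1 - k * q" by auto
    have "k * q < n" "2 * q \<le> k * q" using m k by auto
    moreover have "even (k * q)" using assms(4) by simp
    ultimately have "odd l" "n - 1 - l = k * q"
      using k(3) \<open>even n\<close> by (simp_all add: even_diff_nat)
    moreover have "l < n - 1"
      using k(3) \<open>2 * q \<le> k * q\<close> \<open>k * q < n\<close> assms(3) by linarith
    ultimately show "l \<in> ?L"
      using \<open>2 * q \<le> k * q\<close> by simp
  qed
  moreover have "inj_on (\<lambda>k. n - 1 - k * q) {2..m}"
  proof (rule inj_onI)
    fix x y assume *: "x \<in> {2..m}" "y \<in> {2..m}" "n - 1 - x * q = n - 1 - y * q"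
    then have "x * q < n" "y * q < n" using m by auto
    with *(3) have "x * q = y * q" by linarith
    then show "x = y" using assms(3) by simp
  qed
  ultimately have "card ?L = m - 1"
    by (simp add: card_image)
  \<comment> \<open>The cardinality is 2c - 1 if u is at most q, and 2c otherwise.\<close>
  then have "odd (card ?L) \<longleftrightarrow> u \<le> q"
    using assms(1) by (auto simp: m_def)
  then show ?thesis
    using True assms(4) by auto
qed

text \<open>Modulo 2^h the product is 2^(h-1) W, where W is a sum of Stirling numbers. So
  divisibility means that W is even, that is, that the number of its odd terms is even.\<close>

lemma two_power_dvd_mult_Stirling_iff:
  fixes c h u :: nat
  assumes "c \<ge> 1" "0 < u" "u < 2 ^ h"
  defines "n \<equiv> c * 2 ^ h + u"
  shows "2 ^ h dvd n * Stirling (n - 1) (2 ^ h - 1) \<longleftrightarrow>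
    \<not> ((even u \<and> u \<le> 2 ^ (h - 1)) \<or> u = 1 \<or> u = 1 + 2 ^ (h - 1))"
proof (cases "h \<ge> 2")
  case True
  define g where "g = h - 1"
  have g: "h = Suc g" "g \<ge> 1"
    using True by (auto simp: g_def)
  define q :: nat where "q = 2 ^ g"
  have q: "2 ^ h = 2 * q" "even q"
    using g by (auto simp: q_def)
  define j where "j = n - 1"
  have n: "n = Suc j" "n = 2 * c * q + u"
    using assms q by (auto simp: j_def n_def)
  define W where "W = (\<Sum>l<j. if l = 0 \<or> odd l then int (Stirling (j - 1 - l) (2 ^ h - 1)) else 0)"
  define X where "X = int (n * Stirling (n - 1) (2 ^ h - 1))"
  have dvd: "2 ^ h dvd X - 2 ^ g * W"
    using Stirling_pred_two_power_cong[OF g(2), of j] unfolding W_def X_def g(1) n(1) by simp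
  have "2 ^ h dvd n * Stirling (n - 1) (2 ^ h - 1) \<longleftrightarrow> int (2 ^ h) dvd X"
    unfolding X_def by (rule of_nat_dvd_iff[symmetric])
  also have "int (2 ^ h) dvd X \<longleftrightarrow> 2 ^ h dvd 2 ^ g * W"
    using dvd_add_right_iff[OF dvd, of "2 ^ g * W"] by simp
  also have "\<dots> \<longleftrightarrow> even W"
    by (simp add: g(1))
  also have "\<dots> \<longleftrightarrow> even (card {l \<in> {..<j}. odd (if l = 0 \<or> odd l then int (Stirling (j - 1 - l) (2 ^ h - 1)) else 0)})"
    unfolding W_def by (rule even_sum_iff) simp
  also have "{l \<in> {..<j}. odd (if l = 0 \<or> odd l then int (Stirling (j - 1 - l) (2 ^ h - 1)) else 0)} =
      {l. l < n - 1 \<and> (l = 0 \<or> odd l) \<and> 2 * q \<le> n - 1 - l \<and> q dvd n - 1 - l}"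
  proof (rule Collect_cong)
    fix l
    show "l \<in> {..<j} \<and> odd (if l = 0 \<or> odd l then int (Stirling (j - 1 - l) (2 ^ h - 1)) else 0) \<longleftrightarrow>
        l < n - 1 \<and> (l = 0 \<or> odd l) \<and> 2 * q \<le> n - 1 - l \<and> q dvd n - 1 - l"
    proof (cases "l < j")
      case l: True
      then have "Suc (j - 1 - l) = n - 1 - l"
        by (simp add: n(1))
      with l show ?thesis
        using odd_Stirling_pred_two_power_iff[OF True, of "j - 1 - l"]
        by (simp only: q(1)) (simp add: q_def g(1) n(1))
    qed (simp add: n(1))
  qed
  also have "even (card \<dots>) \<longleftrightarrow> \<not> ((even u \<and> u \<le> q) \<or> u = 1 \<or> u = 1 + q)"
    using card_odd_Stirling_terms[OF assms(1,2) assms(3)[unfolded q(1)] q(2) n(2)] by blast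
  finally show ?thesis
    unfolding q_def g_def .
next
  case False
  \<comment> \<open>Only h = 1 and u = 1 remain; there n = 2c + 1 and S(2c, 1) = 1 are both
    odd.\<close>
  have "h \<noteq> 0"
    using assms(2,3) by (intro notI) simp
  then have "h = 1"
    using False by linarith
  moreover from this have "u = 1"
    using assms(2,3) by simp
  moreover have "Stirling (c * 2) 1 = 1"
    using Stirling_1[of "c * 2 - 1"] assms(1) by simp
  ultimately show ?thesis
    by (simp add: n_def)
qed

section \<open>Coefficients of Bernoulli polynomials and the AMZ bound\<close>

text \<open>With E = e^t - 1, the derivative of E^k is k (E^k + E^(k-1)), which is the recurrence of
  the Stirling numbers on coefficients.\<close>

lemma fps_exp_minus_one_power_nth:
  "(fps_exp 1 - 1 :: rat fps) ^ k $ n = fact k * of_nat (Stirling n k) / fact n"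
proof (induction n arbitrary: k)
  case 0
  then show ?case by (cases k) (simp_all add: fps_nth_power_0)
next
  case (Suc n)
  show ?case
  proof (cases k)
    case (Suc l)
    let ?E = "fps_exp 1 - 1 :: rat fps"
    have "fps_deriv (?E ^ k) = of_nat k * fps_exp 1 * ?E ^ l"
      by (simp only: fps_deriv_power' Suc diff_Suc_1) simp
    also have "\<dots> = of_nat k * (?E ^ k + ?E ^ l)"
      by (simp add: Suc algebra_simps)
    finally have "fps_deriv (?E ^ k) $ n = of_nat k * (?E ^ k $ n + ?E ^ l $ n)"
      by (simp add: fps_mult_of_nat_nth)
    then have "of_nat (Suc n) * ?E ^ k $ Suc n = of_nat k * (?E ^ k $ n + ?E ^ l $ n)"
      by simp
    also have "\<dots> = fact k * of_nat (Stirling (Suc n) k) / fact n"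
      unfolding Suc.IH by (simp add: Suc field_simps)
    finally have "?E ^ k $ Suc n = fact k * of_nat (Stirling (Suc n) k) / fact n / of_nat (Suc n)"
      by (subst nonzero_eq_divide_eq) (simp_all add: mult.commute del: of_nat_Suc Stirling.simps)
    then show ?thesis
      by (simp add: mult.commute del: of_nat_Suc Stirling.simps)
  qed simp
qed

text \<open>The kernel to the power -k, times t^k, is (e^t - 1)^k; hence the index shift by
  k.\<close>

lemma bernoulli_kernel_powi_neg_nth:
  "(bernoulli_kernel powi (- int k)) $ n = fact k * of_nat (Stirling (n + k) k) / fact (n + k)"
proof -
  let ?E = "fps_exp 1 - 1 :: rat fps"
  have "?E ^ k = (bernoulli_kernel powi (- int k) * bernoulli_kernel powi int k) * ?E ^ k"
    using bernoulli_kernel_powi_minus[of "- int k"] by simp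
  also have "\<dots> = bernoulli_kernel powi (- int k) * (bernoulli_kernel * ?E) ^ k"
    by (simp only: power_int_of_nat power_mult_distrib mult.assoc)
  also have "\<dots> = bernoulli_kernel powi (- int k) * fps_X ^ k"
    by (simp only: bernoulli_kernel_mult)
  finally have "?E ^ k $ (n + k) = (bernoulli_kernel powi (- int k)) $ n"
    by (simp only: fps_X_power_mult_right_nth) simp
  then show ?thesis
    by (simp only: fps_exp_minus_one_power_nth)
qed

text \<open>Multiplication by C(N, k) clears the denominators, so that the pole can be computed from
  valuations of integers.\<close>

lemma binomial_mult_coeff_bernoulli_poly:
  assumes "k \<le> j" "j \<le> N"
  shows "of_nat (N choose k) * coeff (bernoulli_poly (N - k) (- int k)) (N - j) =
    of_nat ((N choose j) * Stirling j k)"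
proof -
  have "coeff (bernoulli_poly (N - k) (- int k)) (N - j) =
      fact (N - k) / fact (N - j) * (fact k * of_nat (Stirling j k) / fact j)"
    using assms by (simp add: coeff_bernoulli_poly bernoulli_kernel_powi_neg_nth)
  then show ?thesis
    using assms by (simp add: binomial_fact field_simps)
qed

text \<open>For r = p / q the hypothesis becomes a p = b q over the integers, and multiplicities are
  additive. Positivity of b keeps r away from the default value of \<open>nu2\<close> at 0.\<close>

lemma nu2_eqI:
  assumes "of_nat a * r = of_nat b" "a > 0" "b > 0"
  shows "nu2 r = int (multiplicity 2 b) - int (multiplicity 2 a)"
proof -
  have mult_int: "multiplicity 2 (int x) = multiplicity 2 x" for x
    using nu2_of_nat[of x] quotient_of_int[of "int x"] by (simp add: nu2_def Rat.of_int_def)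
  obtain p q where pq: "quotient_of r = (p, q)"
    by (cases "quotient_of r")
  then have "q > 0" and r: "r = of_int p / of_int q"
    by (simp_all add: quotient_of_denom_pos quotient_of_div)
  have "(of_int (int a * p) :: rat) = (of_nat a * r) * of_int q"
    using \<open>q > 0\<close> by (simp add: r)
  also have "\<dots> = of_int (int b * q)"
    by (simp add: assms(1))
  finally have eq: "int a * p = int b * q"
    by (simp only: of_int_eq_iff)
  then have "p \<noteq> 0"
    using assms(2,3) \<open>q > 0\<close> by auto
  have "multiplicity 2 (int a * p) = multiplicity 2 (int a) + multiplicity 2 p"
    "multiplicity 2 (int b * q) = multiplicity 2 (int b) + multiplicity 2 q"
    using assms(2,3) \<open>p \<noteq> 0\<close> \<open>q > 0\<close> by (auto simp: prime_elem_multiplicity_mult_distrib)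
  then show ?thesis
    using eq by (simp add: nu2_def pq mult_int)
qed

lemma Stirling_pos: "0 < k \<Longrightarrow> k \<le> n \<Longrightarrow> 0 < Stirling n k"
proof (induction n arbitrary: k)
  case (Suc n)
  then obtain l where l: "k = Suc l" "l \<le> n"
    by (cases k) auto
  show ?case
  proof (cases "l = 0")
    case False
    then show ?thesis using Suc.IH[of l] l by simp
  qed (simp add: l Stirling_1 del: Stirling.simps)
qed simp

text \<open>The summands of S(N + 1, k + 1), so the AMZ estimate for S(N, k) is the trivial estimate for this sum.\<close>
lemma amz_bound_eqI:
  assumes "0 < k" "k \<le> N"
    and le: "\<And>j. k \<le> j \<Longrightarrow> j \<le> N \<Longrightarrow> e \<le> int (multiplicity 2 ((N choose j) * Stirling j k))"
    and eq: "k \<le> j0" "j0 \<le> N" "int (multiplicity 2 ((N choose j0) * Stirling j0 k)) = e"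
  shows "amz_bound N k = e"
proof -
  define f where "f = bernoulli_poly (N - k) (- int k)"
  define v where "v = int (multiplicity 2 (N choose k))"
  have nu2: "nu2 (coeff f (N - j)) = int (multiplicity 2 ((N choose j) * Stirling j k)) - v"
    if "k \<le> j" "j \<le> N" for j
    unfolding f_def v_def
    using binomial_mult_coeff_bernoulli_poly[OF that] that assms(1,2) Stirling_pos[of k j]
    by (intro nu2_eqI) auto
  let ?V = "{nu2 (coeff f i) |i. coeff f i \<noteq> 0}"
  \<comment> \<open>The degree is N - k, so every nonzero coefficient sits at N - j for some
    admissible j.\<close>
  have i: "\<exists>j. k \<le> j \<and> j \<le> N \<and> i = N - j" if "coeff f i \<noteq> 0" for i
  proof -
    have "i \<le> N - k"
      using le_degree[OF that] by (simp add: f_def bernoulli_poly_monic)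
    then show ?thesis
      using assms(2) by (intro exI[of _ "N - i"]) auto
  qed
  have nz: "coeff f (N - j) \<noteq> 0" if "k \<le> j" "j \<le> N" for j
    using binomial_mult_coeff_bernoulli_poly[OF that] that assms(1,2) Stirling_pos[of k j]
    unfolding f_def by (intro notI) auto
  have "finite {i. coeff f i \<noteq> 0}"
    by (rule finite_subset[of _ "{..degree f}"]) (auto simp: le_degree)
  then have "finite ?V"
    by (simp add: setcompr_eq_image)
  then have "Min ?V = e - v"
  proof (rule Min_eqI)
    fix y assume "y \<in> ?V"
    then obtain j where "k \<le> j" "j \<le> N" "y = nu2 (coeff f (N - j))"
      using i by blast
    with le[of j] nu2[of j] show "e - v \<le> y" by simp
  next
    have "nu2 (coeff f (N - j0)) = e - v"
      using nu2[OF eq(1,2)] eq(3) by simp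
    then show "e - v \<in> ?V"
      using nz[OF eq(1,2)] by force
  qed
  then show ?thesis
    by (simp add: amz_bound_def max_pole_def f_def[symmetric] v_def)
qed

text \<open>The shifted estimate for S(n, k) is the unshifted one for S(n - 1, k - 1); positivity of
  k makes the truncated \<open>k - 1\<close> agree with the integer shift.\<close>

lemma samz_bound_eq_amz_bound:
  assumes "0 < k"
  shows "samz_bound n k = amz_bound (n - 1) (k - 1)"
proof -
  have "n - 1 - (k - 1) = n - k" "- int (k - 1) = - int k + 1"
    using assms by auto
  then show ?thesis
    by (simp only: samz_bound_def amz_bound_def)
qed

section \<open>From divisibility of multiples to valuations, and the final assembly\<close>

lemma multiplicity_ge_of_dvd_mult:
  fixes n x :: nat
  assumes "2 ^ g dvd n * x" "n > 0" "x > 0"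
  shows "int g - int (multiplicity 2 n) \<le> int (multiplicity 2 x)"
proof -
  have "g \<le> multiplicity 2 (n * x)"
    using assms by (intro multiplicity_geI) auto
  also have "\<dots> = multiplicity 2 n + multiplicity 2 x"
    using assms by (intro prime_elem_multiplicity_mult_distrib) auto
  finally show ?thesis by linarith
qed

lemma multiplicity_eq_iff_of_dvd_mult:
  fixes n x :: nat
  assumes "2 ^ g dvd n * x" "n > 0" "x > 0"
  shows "int (multiplicity 2 x) = int g - int (multiplicity 2 n) \<longleftrightarrow> \<not> 2 ^ Suc g dvd n * x"
proof -
  have "g \<le> multiplicity 2 (n * x)"
    using assms by (intro multiplicity_geI) auto
  moreover have "2 ^ Suc g dvd n * x \<longleftrightarrow> Suc g \<le> multiplicity 2 (n * x)"
    using assms by (intro power_dvd_iff_le_multiplicity) auto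
  moreover have "multiplicity 2 (n * x) = multiplicity 2 n + multiplicity 2 x"
    using assms by (intro prime_elem_multiplicity_mult_distrib) auto
  ultimately show ?thesis by linarith
qed

theorem theorem3p27:
  fixes h u c :: nat
  assumes "c \<ge> 1" and "u \<le> 2 ^ h" and "0 < u" and "u < 2 ^ h"
  shows "samz_bound (c * 2 ^ h + u) (2 ^ h) = int h - 1 - nu2 (of_nat u) \<and>
         nu2 (of_nat (Stirling (c * 2 ^ h + u) (2 ^ h))) \<ge> int h - 1 - nu2 (of_nat u) \<and>
         (SAMZC (c * 2 ^ h + u) (2 ^ h) \<longleftrightarrow>
            (even u \<and> u \<le> 2 ^ (h - 1)) \<or> u = 1 \<or> u = 1 + 2 ^ (h - 1)) \<and>
         ((even u \<and> u \<le> 2 ^ (h - 1)) \<or> u = 1 \<or> u = 1 + 2 ^ (h - 1)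
          \<longrightarrow>
            AMZC (c * 2 ^ h + u - 1) (2 ^ h - 1) \<and>
            nu2 (of_nat (Stirling (c * 2 ^ h + u) (2 ^ h))) =
              nu2 (of_nat (Stirling (c * 2 ^ h + u - 1) (2 ^ h - 1))) \<and>
            nu2 (of_nat (Stirling (c * 2 ^ h + u - 1) (2 ^ h - 1))) =
              int h - 1 - nu2 (of_nat u))"
proof -
  obtain v m where u: "u = 2 ^ v * m" "odd m" "v < h" "multiplicity 2 u = v"
    using odd_part_obtain assms(3,4) by blast
  define g where "g = h - 1"
  have g: "h = Suc g"
    using u(3) by (simp add: g_def)
  define K :: nat where "K = 2 ^ h - 1"
  have K: "2 ^ h = Suc K" "0 < K"
    using one_less_power[of "2::nat" h] by (simp_all add: K_def g)
  define N where "N = c * 2 ^ h + u - 1"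
  define n where "n = c * 2 ^ h + u"
  have n: "n = Suc N" "N = n - 1"
    using assms(3) by (simp_all add: N_def n_def)
  have "1 * 2 ^ h \<le> c * 2 ^ h"
    using assms(1) by (intro mult_le_mono1)
  then have "2 ^ h \<le> N"
    using assms(3) unfolding N_def by linarith
  then have "K \<le> N"
    by (simp add: K_def)
  define e where "e = int g - int v"
  let ?L = "(even u \<and> u \<le> 2 ^ (h - 1)) \<or> u = 1 \<or> u = 1 + 2 ^ (h - 1)"
  \<comment> \<open>Since v < h, adding a multiple of 2^h to u does not change its
    valuation.\<close>
  have n_v: "multiplicity 2 n = v"
  proof (rule multiplicity_eqI)
    have n': "n = 2 ^ v * (c * 2 ^ (h - v) + m)"
      using u(1,3) by (simp add: n_def distrib_left flip: power_add)
    then show "2 ^ v dvd n" by simp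
    have "odd (c * 2 ^ (h - v) + m)"
      using u(2,3) by simp
    then show "\<not> 2 ^ Suc v dvd n"
      by (simp add: n' mult.commute[of 2])
  qed
  have absorb: "n * ((N choose j) * Stirling j K) = (n choose Suc j) * (Suc j * Stirling j K)" for j
    by (simp only: n(1) mult.assoc[symmetric] Suc_times_binomial_eq)
  have dvd: "2 ^ g dvd n * ((N choose j) * Stirling j K)" for j
    unfolding absorb unfolding K_def g_def by (rule dvd_mult[OF two_power_dvd_Suc_mult_Stirling])
  have pos: "0 < (N choose j) * Stirling j K" if "K \<le> j" "j \<le> N" for j
    using that Stirling_pos[of K j] K(2) by simp
  have amz: "amz_bound N K = e"
  proof (rule amz_bound_eqI)
    fix j assume j: "K \<le> j" "j \<le> N"
    show "e \<le> int (multiplicity 2 ((N choose j) * Stirling j K))"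
      using multiplicity_ge_of_dvd_mult[OF dvd _ pos[OF j]] by (simp add: n(1) e_def flip: n_v)
  next
    \<comment> \<open>Keeping only the lowest bit of u makes C(n, j0 + 1) odd, and
      \<open>2 ^ v\<close> always belongs to the listed cases: it is 1, or even and at most
      2^(h-1).\<close>
    define j0 where "j0 = c * 2 ^ h + 2 ^ v - 1"
    have j0: "Suc j0 = c * 2 ^ h + 2 ^ v"
      by (simp add: j0_def)
    have "2 ^ v \<le> u"
      using u(1,2) by (simp add: odd_pos Suc_le_eq)
    then show "j0 \<le> N"
      using j0 n by (simp add: n_def)
    show "K \<le> j0"
      using \<open>1 * 2 ^ h \<le> c * 2 ^ h\<close> unfolding K_def j0_def by linarith
    have "\<not> 2 ^ h dvd Suc j0 * Stirling j0 K"
    proof -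
      have "(2 :: nat) ^ v < 2 ^ h" "(2 :: nat) ^ v \<le> 2 ^ (h - 1)"
        using u(3) by simp_all
      moreover have "even ((2 :: nat) ^ v) \<or> (2 :: nat) ^ v = 1"
        by (cases v) simp_all
      ultimately show ?thesis
        using two_power_dvd_mult_Stirling_iff[of c "2 ^ v" h] assms(1)
        unfolding j0[symmetric] diff_Suc_1 K_def by (metis zero_less_numeral zero_less_power)
    qed
    moreover have "odd (n choose Suc j0)"
      using odd_choose_lowest_bit[of u h c] assms(3,4) by (simp add: u(4) n_def j0)
    ultimately have "\<not> 2 ^ Suc g dvd n * ((N choose j0) * Stirling j0 K)"
      unfolding absorb g by (simp add: coprime_dvd_mult_right_iff)
    then show "int (multiplicity 2 ((N choose j0) * Stirling j0 K)) = e"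
      using multiplicity_eq_iff_of_dvd_mult[OF dvd _ pos[OF \<open>K \<le> j0\<close> \<open>j0 \<le> N\<close>]]
      by (simp add: n(1) e_def flip: n_v)
  qed (use K(2) \<open>K \<le> N\<close> in auto)
  \<comment> \<open>The summand j = N, whose binomial coefficient is 1.\<close>
  have N_dvd: "2 ^ g dvd n * Stirling N K"
    using dvd[of N] by simp
  have N_iff: "2 ^ Suc g dvd n * Stirling N K \<longleftrightarrow> \<not> ?L"
    using two_power_dvd_mult_Stirling_iff[OF assms(1,3,4)] by (simp only: g[symmetric] K_def N_def n_def)
  have N_pos: "0 < Stirling N K"
    using Stirling_pos K(2) \<open>K \<le> N\<close> by blast
  have "Stirling n (2 ^ h) = 2 ^ h * Stirling N (2 ^ h) + Stirling N K"
    unfolding n(1) K(1) by (rule Stirling.simps(4))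
  then have eq: "n * Stirling n (2 ^ h) = 2 ^ Suc g * (n * Stirling N (2 ^ h)) + n * Stirling N K"
    by (simp add: g algebra_simps)
  have n_dvd: "2 ^ g dvd n * Stirling n (2 ^ h)"
    unfolding eq using N_dvd by (intro dvd_add) auto
  have n_iff: "2 ^ Suc g dvd n * Stirling n (2 ^ h) \<longleftrightarrow> \<not> ?L"
    unfolding eq N_iff[symmetric] by (rule dvd_add_right_iff) (rule dvd_triv_left)
  have n_pos: "0 < Stirling n (2 ^ h)"
    using Stirling_pos \<open>2 ^ h \<le> N\<close> n(1) by simp
  have "0 < n"
    by (simp add: n(1))
  have n_ge: "e \<le> int (multiplicity 2 (Stirling n (2 ^ h)))"
    using multiplicity_ge_of_dvd_mult[OF n_dvd \<open>0 < n\<close> n_pos] by (simp add: e_def n_v)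
  have n_eq: "int (multiplicity 2 (Stirling n (2 ^ h))) = e \<longleftrightarrow> ?L"
    using multiplicity_eq_iff_of_dvd_mult[OF n_dvd \<open>0 < n\<close> n_pos] n_iff unfolding e_def n_v by blast
  have N_eq: "int (multiplicity 2 (Stirling N K)) = e \<longleftrightarrow> ?L"
    using multiplicity_eq_iff_of_dvd_mult[OF N_dvd \<open>0 < n\<close> N_pos] N_iff unfolding e_def n_v by blast
  \<comment> \<open>S(n, 2^h) and S(N, K) are compared with the same bound e, so both attain it
    exactly for the listed u.\<close>
  have samz: "samz_bound n (2 ^ h) = e"
    using samz_bound_eq_amz_bound[of "2 ^ h" n] amz by (simp add: K_def n(2))
  have e_eq: "int h - 1 - int (multiplicity 2 u) = e"
    by (simp add: e_def g u(4))
  have "int (multiplicity 2 (Stirling n (2 ^ h))) = int (multiplicity 2 (Stirling N K))" if ?L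
    using that n_eq N_eq by presburger
  then show ?thesis
    unfolding SAMZC_def AMZC_def nu2_of_nat N_def[symmetric] unfolding n_def[symmetric] K_def[symmetric]
    unfolding samz amz e_eq using n_ge n_eq N_eq by blast
qed

end
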